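(* Let $M=\mathbb{C}[d_0]$ be equipped with a $\mathcal{W}_1^+$-module structure in which $d_0\in\mathcal{W}_1^+$ acts by left multiplication by $d_0$. Then either $M\cong\Omega(\lambda,a)$ as $\mathcal{W}_1^+$-modules for some $\lambda\in\mathbb{C}^*$ and $a\in\mathbb{C}$, or $M\cong\Gamma(\lambda,a)$ as $\mathcal{W}_1^+$-modules for some $\lambda\in\mathbb{C}^*$ and $a\in\mathbb{C}$.
   Context: $\mathbb{N}$ is the set of positive integers and $\mathbb{C}^*=\mathbb{C}\setminus\{0\}$. $\mathcal{W}_1^+=\mathrm{Der}\,\mathbb{C}[t]$ is the complex Lie algebra of derivations of $\mathbb{C}[t]$; it has basis $d_i=t^{i+1}\frac{d}{dt}$, $i\ge -1$, with bracket $[d_i,d_j]=(j-i)d_{i+j}$. For $\lambda\in\mathbb{C}^*$, $a\in\mathbb{C}$, the $\mathcal{W}_1^+$-module $\Omega(\lambda,a)$ is the vector space $\mathbb{C}[x]$ with action $$d_i f(x)=\lambda^i\,(x-i(a+1))\,f(x-i),\qquad i\ge -1,\ f(x)\in\mathbb{C}[x].$$ For $\lambda\in\mathbb{C}^*$, $a\in\mathbb{C}$, the $\mathcal{W}_1^+$-module $\Gamma(\lambda,a)$ is the vector space $\mathbb{C}[x]$ with action $$d_{-1}\cdot f(x)=\lambda^{-1}f(x+1),\qquad d_0\cdot f(x)=xf(x),$$ $$d_k\cdot f(x)=\lambda^k f(x-k)\,(x-k(a+1))\prod_{i=0}^{k-1}(x+a-i),\qquad k\in\mathbb{N},\ f(x)\in\mathbb{C}[x].$$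 *)

theory Defs
  imports "HOL-Computational_Algebra.Polynomial"
begin

definition W1p :: "(complex poly \<Rightarrow> complex poly) set" where
  "W1p = {D. Vector_Spaces.linear smult smult D \<and> (\<forall>f g. D (f * g) = D f * g + f * D g)}"

definition W1p_bracket ::
  "(complex poly \<Rightarrow> complex poly) \<Rightarrow> (complex poly \<Rightarrow> complex poly) \<Rightarrow> complex poly \<Rightarrow> complex poly" where
  "W1p_bracket D E = (\<lambda>f. D (E f) - E (D f))"

(* d_i = t^(i+1) d/dt; only meaningful for i >= -1 because nat truncates. *)
definition W1p_d :: "int \<Rightarrow> complex poly \<Rightarrow> complex poly" where
  "W1p_d i = (\<lambda>f. monom 1 (nat (i + 1)) * pderiv f)"

(* The action is only constrained on derivations; its values elsewhere are junk. *)
locale W1p_module = vector_space scale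
  for scale :: "complex \<Rightarrow> 'v::ab_group_add \<Rightarrow> 'v" +
  fixes act :: "(complex poly \<Rightarrow> complex poly) \<Rightarrow> 'v \<Rightarrow> 'v"
  assumes act_linear: "D \<in> W1p \<Longrightarrow> Vector_Spaces.linear scale scale (act D)"
    and act_add: "\<lbrakk>D \<in> W1p; E \<in> W1p\<rbrakk> \<Longrightarrow> act (\<lambda>f. D f + E f) v = act D v + act E v"
    and act_smult: "D \<in> W1p \<Longrightarrow> act (\<lambda>f. smult c (D f)) v = scale c (act D v)"
    and act_bracket: "\<lbrakk>D \<in> W1p; E \<in> W1p\<rbrakk> \<Longrightarrow>
      act (W1p_bracket D E) v = act D (act E v) - act E (act D v)"

definition W1p_isomorphic ::
  "(complex \<Rightarrow> 'v::ab_group_add \<Rightarrow> 'v) \<Rightarrow> ((complex poly \<Rightarrow> complex poly) \<Rightarrow> 'v \<Rightarrow> 'v) \<Rightarrow>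
   (complex \<Rightarrow> 'w::ab_group_add \<Rightarrow> 'w) \<Rightarrow> ((complex poly \<Rightarrow> complex poly) \<Rightarrow> 'w \<Rightarrow> 'w) \<Rightarrow> bool" where
  "W1p_isomorphic scale1 act1 scale2 act2 \<longleftrightarrow>
     W1p_module scale1 act1 \<and> W1p_module scale2 act2 \<and>
     (\<exists>\<phi>. Vector_Spaces.linear scale1 scale2 \<phi> \<and> bij \<phi> \<and>
          (\<forall>D\<in>W1p. \<forall>v. \<phi> (act1 D v) = act2 D (\<phi> v)))"

(* Linear extension of an action prescribed on the basis d_i, i >= -1: a derivation D equals
   p d/dt with p = D t, that is, the sum of coeff p n times d_(n-1).  See W1p_expand below. *)
definition W1p_extend ::
  "(int \<Rightarrow> complex poly \<Rightarrow> complex poly) \<Rightarrow> (complex poly \<Rightarrow> complex poly) \<Rightarrow> complex poly \<Rightarrow> complex poly" where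
  "W1p_extend B D f =
     (\<Sum>n\<le>degree (D [:0, 1:]). smult (coeff (D [:0, 1:]) n) (B (int n - 1) f))"

definition shift :: "int \<Rightarrow> complex poly \<Rightarrow> complex poly" where
  "shift i f = pcompose f [:- of_int i, 1:]"

lemma poly_shift: "poly (shift i f) x = poly f (x - of_int i)"
  by (simp add: shift_def poly_pcompose)

definition Omega_basis :: "complex \<Rightarrow> complex \<Rightarrow> int \<Rightarrow> complex poly \<Rightarrow> complex poly" where
  "Omega_basis lam a i f = smult (lam powi i) ([:- (of_int i * (a + 1)), 1:] * shift i f)"

definition Gamma_basis :: "complex \<Rightarrow> complex \<Rightarrow> int \<Rightarrow> complex poly \<Rightarrow> complex poly" where
  "Gamma_basis lam a k f =
     (if k = -1 then smult (inverse lam) (shift (-1) f)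
      else if k = 0 then [:0, 1:] * f
      else smult (lam powi k)
             (shift k f * [:- (of_int k * (a + 1)), 1:] * (\<Prod>i<nat k. [:a - of_nat i, 1:])))"

definition Omega ::
  "complex \<Rightarrow> complex \<Rightarrow> (complex poly \<Rightarrow> complex poly) \<Rightarrow> complex poly \<Rightarrow> complex poly" where
  "Omega lam a = W1p_extend (Omega_basis lam a)"

definition Gamma ::
  "complex \<Rightarrow> complex \<Rightarrow> (complex poly \<Rightarrow> complex poly) \<Rightarrow> complex poly \<Rightarrow> complex poly" where
  "Gamma lam a = W1p_extend (Gamma_basis lam a)"


lemma vector_space_smult: "vector_space (smult :: complex \<Rightarrow> complex poly \<Rightarrow> complex poly)"
  by unfold_locales (simp_all add: smult_add_right smult_add_left)

lemma linear_smultI: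
  fixes F :: "complex poly \<Rightarrow> complex poly"
  assumes "\<And>f g. F (f + g) = F f + F g" "\<And>c f. F (smult c f) = smult c (F f)"
  shows "Vector_Spaces.linear smult smult F"
  using assms
  by (simp add: Vector_Spaces.linear_def vector_space_smult module_hom_def module_hom_axioms_def
      module_iff_vector_space)

lemma linear_smultD:
  fixes F :: "complex poly \<Rightarrow> complex poly"
  assumes "Vector_Spaces.linear smult smult F"
  shows "F (f + g) = F f + F g" "F (smult c f) = smult c (F f)"
  using assms
  by (simp_all add: Vector_Spaces.linear_def module_hom_def module_hom_axioms_def)

lemma W1p_mult_pderiv: "(\<lambda>f. p * pderiv f) \<in> W1p"
  unfolding W1p_def
  by (auto intro!: linear_smultI simp: pderiv_add pderiv_smult pderiv_mult algebra_simps)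

lemma W1p_eq: assumes "D \<in> W1p" shows "D f = D [:0, 1:] * pderiv f"
proof -
  have lin: "Vector_Spaces.linear smult smult D" and L: "\<And>f g. D (f * g) = D f * g + f * D g"
    using assms by (auto simp: W1p_def)
  note A = linear_smultD[OF lin]
  have one: "D 1 = 0" using L[of 1 1] by simp
  have Z: "D 0 = 0" using A(2)[of 0 0] by simp
  have C: "D [:c:] = 0" for c using A(2)[of c 1] one by (simp add: one_pCons)
  show ?thesis
  proof (induction f)
    case 0 then show ?case using Z by simp
  next
    case (pCons c f)
    have e: "pCons c f = [:c:] + [:0, 1:] * f" by simp
    have "D (pCons c f) = D [:0, 1:] * f + [:0, 1:] * D f"
      unfolding e A(1) C L by simp
    also have "\<dots> = D [:0, 1:] * (f + [:0, 1:] * pderiv f)"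
      by (subst pCons.IH) (simp add: algebra_simps)
    also have "f + [:0, 1:] * pderiv f = pderiv (pCons c f)"
      by (simp add: pderiv_pCons)
    finally show ?case .
  qed
qed

lemma W1p_d_in: "W1p_d i \<in> W1p"
  unfolding W1p_d_def by (rule W1p_mult_pderiv)

lemma W1p_d_X: "W1p_d i [:0, 1:] = monom 1 (nat (i + 1))"
  by (simp add: W1p_d_def pderiv_pCons one_pCons[symmetric])

lemma W1p_expand:
  assumes "D \<in> W1p"
  shows "D f = (\<Sum>n\<le>degree (D [:0, 1:]). smult (coeff (D [:0, 1:]) n) (W1p_d (int n - 1) f))"
proof -
  have 1: "smult c (W1p_d (int n - 1) f) = monom c n * pderiv f" for c n
  proof -
    have "smult c (W1p_d (int n - 1) f) = smult c (monom 1 n) * pderiv f"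
      by (simp only: W1p_d_def mult_smult_left diff_add_cancel nat_int)
    then show ?thesis by (simp only: smult_monom mult_1_right)
  qed
  show ?thesis
    by (subst W1p_eq[OF assms]) (simp only: 1 sum_distrib_right[symmetric] poly_as_sum_of_monoms)
qed

lemma W1p_bracket_in: assumes "D \<in> W1p" "E \<in> W1p" shows "W1p_bracket D E \<in> W1p"
proof -
  have "W1p_bracket D E = (\<lambda>f. (D [:0, 1:] * pderiv (E [:0, 1:]) - E [:0, 1:] * pderiv (D [:0, 1:])) * pderiv f)"
  proof
    fix f
    have "W1p_bracket D E f = D [:0, 1:] * pderiv (E [:0, 1:] * pderiv f) - E [:0, 1:] * pderiv (D [:0, 1:] * pderiv f)"
      unfolding W1p_bracket_def
      using W1p_eq[OF assms(1), of "E f"] W1p_eq[OF assms(2), of "D f"]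
        W1p_eq[OF assms(1), of f] W1p_eq[OF assms(2), of f] by metis
    then show "W1p_bracket D E f = (D [:0, 1:] * pderiv (E [:0, 1:]) - E [:0, 1:] * pderiv (D [:0, 1:])) * pderiv f"
      by (simp add: pderiv_mult algebra_simps)
  qed
  then show ?thesis using W1p_mult_pderiv by metis
qed

lemma W1p_bracket_X:
  assumes "D \<in> W1p" "E \<in> W1p"
  shows "W1p_bracket D E [:0, 1:] = D [:0, 1:] * pderiv (E [:0, 1:]) - E [:0, 1:] * pderiv (D [:0, 1:])"
  unfolding W1p_bracket_def
  using W1p_eq[OF assms(1), of "E [:0, 1:]"] W1p_eq[OF assms(2), of "D [:0, 1:]"] by metis

lemma monom_bracket:
  "monom (c::complex) m * pderiv (monom d n) - monom d n * pderiv (monom c m) =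
   smult (c * d * (of_nat n - of_nat m)) (monom 1 (m + n - 1))"
  by (cases m; cases n)
    (auto simp: pderiv_monom mult_monom smult_monom diff_monom minus_monom algebra_simps)

lemma W1p_bracket_d:
  assumes "i \<ge> -1" "j \<ge> -1"
  shows "W1p_bracket (W1p_d i) (W1p_d j) f = smult (of_int (j - i)) (W1p_d (i + j) f)"
proof -
  define m n where "m = nat (i + 1)" and "n = nat (j + 1)"
  have ij: "i = int m - 1" "j = int n - 1" using assms by (auto simp: m_def n_def)
  have "W1p_bracket (W1p_d i) (W1p_d j) f =
      (monom 1 m * pderiv (monom 1 n) - monom 1 n * pderiv (monom 1 m)) * pderiv f"
    by (subst W1p_eq[OF W1p_bracket_in[OF W1p_d_in W1p_d_in]])
       (simp only: W1p_bracket_X W1p_d_in W1p_d_X m_def n_def)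
  also have "\<dots> = smult (of_int (j - i)) (monom 1 (m + n - 1) * pderiv f)"
    by (simp only: monom_bracket) (simp add: ij)
  also have "monom 1 (m + n - 1) * pderiv f = W1p_d (i + j) f"
  proof -
    have "nat (i + j + 1) = m + n - 1" unfolding ij by linarith
    then show ?thesis by (simp only: W1p_d_def)
  qed
  finally show ?thesis .
qed


lemma poly_monom_induct:
  assumes "P 0" "\<And>p q. P p \<Longrightarrow> P q \<Longrightarrow> P (p + q)" "\<And>c n. P (monom (c::complex) n)"
  shows "P p"
proof -
  have "P (\<Sum>i\<le>N. monom (coeff p i) i)" for N
    by (induction N) (auto intro: assms)
  then show ?thesis by (metis poly_as_sum_of_monoms)
qed

lemma smult_sum_right: "smult c (\<Sum>x\<in>X. f x) = (\<Sum>x\<in>X. smult c (f x))"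
  by (induction X rule: infinite_finite_induct) (simp_all add: smult_add_right)

lemma W1p_extend_module:
  fixes B :: "int \<Rightarrow> complex poly \<Rightarrow> complex poly"
  assumes lin: "\<And>i. i \<ge> -1 \<Longrightarrow> Vector_Spaces.linear smult smult (B i)"
    and br: "\<And>i j f. i \<ge> -1 \<Longrightarrow> j \<ge> -1 \<Longrightarrow>
      B i (B j f) - B j (B i f) = smult (of_int (j - i)) (B (i + j) f)"
  shows "W1p_module smult (W1p_extend B)"
proof -
  define A where "A p f = (\<Sum>n\<le>degree p. smult (coeff p n) (B (int n - 1) f))" for p f
  have ext: "W1p_extend B D f = A (D [:0, 1:]) f" for D f by (simp add: W1p_extend_def A_def)
  have AN: "A p f = (\<Sum>n\<le>N. smult (coeff p n) (B (int n - 1) f))" if "degree p \<le> N" for p f N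
    unfolding A_def by (rule sum.mono_neutral_left) (use that in \<open>auto simp: coeff_eq_0\<close>)
  have Aadd: "A (p + q) f = A p f + A q f" for p q f
  proof -
    let ?N = "max (degree p) (degree q)"
    have "degree (p + q) \<le> ?N" by (rule degree_add_le_max)
    then show ?thesis
      by (simp add: AN[of _ ?N] sum.distrib smult_add_left)
  qed
  have Asm: "A (smult c p) f = smult c (A p f)" for c p f
    by (cases "c = 0") (simp_all add: A_def smult_sum_right)
  have Adiff: "A (p - q) f = A p f - A q f" for p q f
    using Aadd[of "p - q" q f] by simp
  have A0: "A 0 f = 0" for f by (simp add: A_def)
  have Amon: "A (monom c n) f = smult c (B (int n - 1) f)" for c n f
  proof -
    have "A (monom c n) f = (\<Sum>k\<le>n. if k = n then smult c (B (int n - 1) f) else 0)"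
      unfolding AN[OF degree_monom_le] by (rule sum.cong) auto
    then show ?thesis by simp
  qed
  have Bl: "B (int n - 1) (f + g) = B (int n - 1) f + B (int n - 1) g"
    "B (int n - 1) (smult c f) = smult c (B (int n - 1) f)" for n c f g
    using linear_smultD[OF lin[of "int n - 1"]] by simp_all
  have Al: "A p (f + g) = A p f + A p g" "A p (smult c f) = smult c (A p f)" for p f g c
    by (simp_all add: A_def Bl smult_add_right sum.distrib smult_sum_right mult.commute)
  have A00: "A p 0 = 0" for p using Al(2)[of p 0 0] by simp
  have Abr: "A (p * pderiv q - q * pderiv p) f = A p (A q f) - A q (A p f)" for p q f
  proof (induction p rule: poly_monom_induct)
    case 1 show ?case by (simp add: A0 A00)
  next
    case (2 p p')
    have "(p + p') * pderiv q - q * pderiv (p + p') =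
      (p * pderiv q - q * pderiv p) + (p' * pderiv q - q * pderiv p')"
      by (simp add: pderiv_add algebra_simps)
    then show ?case using 2 by (simp only: Aadd Al) simp
  next
    case (3 c m)
    show ?case
    proof (induction q rule: poly_monom_induct)
      case 1 show ?case by (simp add: A0 A00)
    next
      case (2 q q')
      have "monom c m * pderiv (q + q') - (q + q') * pderiv (monom c m) =
        (monom c m * pderiv q - q * pderiv (monom c m)) + (monom c m * pderiv q' - q' * pderiv (monom c m))"
        by (simp add: pderiv_add algebra_simps)
      then show ?case using 2 by (simp only: Aadd Al) simp
    next
      case (3 d n)
      have "A (monom c m) (A (monom d n) f) - A (monom d n) (A (monom c m) f) =
        smult (c * d) (B (int m - 1) (B (int n - 1) f) - B (int n - 1) (B (int m - 1) f))"
        by (simp only: Amon Bl smult_smult smult_diff_right) (simp add: mult.commute)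
      also have "\<dots> = smult (c * d * (of_nat n - of_nat m)) (B (int m + int n - 2) f)"
        by (subst br) (simp_all add: algebra_simps)
      also have "\<dots> = A (monom c m * pderiv (monom d n) - monom d n * pderiv (monom c m)) f"
      proof (cases "m + n = 0")
        case True then show ?thesis by (simp add: monom_bracket A0)
      next
        case False
        then have e: "int (m + n - 1) - 1 = int m + int n - 2" by linarith
        show ?thesis by (simp only: monom_bracket Asm Amon e) simp
      qed
      finally show ?case by simp
    qed
  qed
  show ?thesis
  proof (intro W1p_module.intro W1p_module_axioms.intro vector_space_smult)
    fix D assume "D \<in> W1p"
    show "Vector_Spaces.linear smult smult (W1p_extend B D)"
      by (rule linear_smultI) (simp_all only: ext Al)
  next
    fix D E v assume "D \<in> W1p" "E \<in> W1p"
    then show "W1p_extend B (W1p_bracket D E) v =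
        W1p_extend B D (W1p_extend B E v) - W1p_extend B E (W1p_extend B D v)"
      by (simp only: ext W1p_bracket_X Abr)
  qed (simp_all only: ext Aadd Asm)
qed

lemma W1p_extend_d: "i \<ge> -1 \<Longrightarrow> W1p_extend B (W1p_d i) f = B i f"
proof -
  assume i: "i \<ge> -1"
  have "W1p_extend B (W1p_d i) f = (\<Sum>k\<le>nat (i + 1). if k = nat (i + 1) then B i f else 0)"
    unfolding W1p_extend_def W1p_d_X
    using i by (intro sum.cong) (auto simp: degree_monom_eq)
  then show ?thesis by simp
qed

lemma Omega_d: "i \<ge> -1 \<Longrightarrow> Omega lam a (W1p_d i) f =
    smult (lam powi i) ([:- (of_int i * (a + 1)), 1:] * shift i f)"
  by (simp add: Omega_def W1p_extend_d Omega_basis_def)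

lemma Gamma_d: "i \<ge> -1 \<Longrightarrow> Gamma lam a (W1p_d i) f = Gamma_basis lam a i f"
  by (simp add: Gamma_def W1p_extend_d)

lemma Omega_module: assumes "lam \<noteq> 0" shows "W1p_module smult (Omega lam a)"
  unfolding Omega_def
proof (rule W1p_extend_module)
  fix i j :: int and f :: "complex poly"
  show "Vector_Spaces.linear smult smult (Omega_basis lam a i)"
    by (rule linear_smultI)
      (simp_all add: Omega_basis_def shift_def pcompose_add pcompose_smult smult_add_right
        distrib_left mult_ac)
  have "poly (Omega_basis lam a i (Omega_basis lam a j f) - Omega_basis lam a j (Omega_basis lam a i f)) x =
        poly (smult (of_int (j - i)) (Omega_basis lam a (i + j) f)) x" for x
  proof -
    have e: "x - of_int j - of_int i = x - of_int i - of_int j" by simp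
    show ?thesis
      by (simp add: Omega_basis_def poly_shift power_int_add assms e diff_diff_eq) (simp add: algebra_simps)
  qed
  then show "Omega_basis lam a i (Omega_basis lam a j f) - Omega_basis lam a j (Omega_basis lam a i f) =
        smult (of_int (j - i)) (Omega_basis lam a (i + j) f)"
    using poly_eq_poly_eq_iff by blast
qed

lemma Gamma_module: assumes "lam \<noteq> 0" shows "W1p_module smult (Gamma lam a)"
  unfolding Gamma_def
proof (rule W1p_extend_module)
  fix i j :: int and f :: "complex poly"
  let ?B = "Gamma_basis lam a"
  show "Vector_Spaces.linear smult smult (Gamma_basis lam a i)"
    by (rule linear_smultI)
      (simp_all add: Gamma_basis_def shift_def pcompose_add pcompose_smult smult_add_right
        distrib_left distrib_right mult_ac)
  assume i: "i \<ge> -1" and j: "j \<ge> -1"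
  define Q where "Q n x = (\<Prod>i<n. x + a - of_nat i)" for n :: nat and x :: complex
  have Qadd: "Q (m + n) x = Q m x * Q n (x - of_nat m)" for m n x
    by (induction n) (simp_all add: Q_def algebra_simps)
  have Q1: "Q (Suc n) x = (x + a) * Q n (x - 1)" for n x
    using Qadd[of 1 n x] by (simp add: Q_def)
  have Q2: "Q (Suc n) x = Q n x * (x + a - of_nat n)" for n x
    by (simp add: Q_def)
  have neg: "poly (?B (-1) g) x = inverse lam * poly g (x + 1)" for g x
    by (simp add: Gamma_basis_def poly_shift)
  have nonneg: "poly (?B (int n) g) x = lam ^ n * poly g (x - of_nat n) * (x - of_nat n * (a + 1)) * Q n x"
    for n g x
    by (simp add: Gamma_basis_def poly_shift poly_prod Q_def algebra_simps)
  have main: "poly (?B (int m) (?B (int n) g)) x - poly (?B (int n) (?B (int m) g)) x =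
      (of_nat n - of_nat m) * poly (?B (int (m + n)) g) x" for m n g x
  proof -
    have "poly (?B (int m) (?B (int n) g)) x =
      lam ^ (m + n) * poly g (x - of_nat m - of_nat n) * Q (m + n) x *
      ((x - of_nat m * (a + 1)) * (x - of_nat m - of_nat n * (a + 1)))" for m n
      by (simp only: nonneg Qadd power_add) (simp add: mult_ac)
    note e = this
    have s: "x - of_nat n - of_nat m = x - of_nat m - of_nat n" by simp
    define G where "G = lam ^ (m + n) * poly g (x - of_nat m - of_nat n) * Q (m + n) x"
    have a: "poly (?B (int n) (?B (int m) g)) x =
        G * ((x - of_nat n * (a + 1)) * (x - of_nat n - of_nat m * (a + 1)))"
      by (subst e[of n m]) (simp only: s G_def add.commute[of n m])
    have b: "poly (?B (int (m + n)) g) x = G * (x - (of_nat m + of_nat n) * (a + 1))"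
      by (subst nonneg) (simp add: G_def diff_diff_eq mult_ac)
    show ?thesis
      unfolding e[of m n] G_def[symmetric] a b by (simp add: algebra_simps)
  qed
  have low: "poly (?B (-1) (?B (int n) g)) x - poly (?B (int n) (?B (-1) g)) x =
      (of_nat n + 1) * poly (?B (int n - 1) g) x" for n g x
  proof (cases n)
    case 0
    show ?thesis using nonneg[of 0 g x] nonneg[of 0 "?B (-1) g" x] nonneg[of 0 g "x + 1"] 0
      by (simp add: neg Q_def algebra_simps)
  next
    case (Suc k)
    have a: "int n - 1 = int k" using Suc by simp
    have L: "inverse lam * (lam ^ n * y) = lam ^ k * y" "lam ^ n * (inverse lam * y) = lam ^ k * y" for y
      using assms by (simp_all add: Suc)
    have s: "x + 1 - of_nat n = x - of_nat k" "x - of_nat n + 1 = x - of_nat k"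
      by (simp_all add: Suc)
    have "Q n (x + 1) = (x + a + 1) * Q k x"
      unfolding Suc Q1 by (simp add: algebra_simps)
    then have b: "poly (?B (-1) (?B (int n) g)) x =
      lam ^ k * (poly g (x - of_nat k) * (x + 1 - of_nat n * (a + 1)) * ((x + a + 1) * Q k x))"
      unfolding neg nonneg s mult.assoc L by simp
    have "Q n x = Q k x * (x + a - of_nat k)"
      unfolding Suc Q2 ..
    then have c: "poly (?B (int n) (?B (-1) g)) x =
      lam ^ k * (poly g (x - of_nat k) * (x - of_nat n * (a + 1)) * (Q k x * (x + a - of_nat k)))"
      unfolding neg nonneg s mult.assoc L by simp
    show ?thesis unfolding b c unfolding a nonneg by (simp add: Suc) (simp add: algebra_simps)
  qed
  have "poly (?B i (?B j f) - ?B j (?B i f)) x = poly (smult (of_int (j - i)) (?B (i + j) f)) x" for x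
  proof -
    have ex: "k = -1 \<or> (\<exists>n. k = int n)" if "k \<ge> -1" for k :: int
      using that by presburger
    consider m n where "i = int m" "j = int n" | n where "i = -1" "j = int n"
      | m where "i = int m" "j = -1" | "i = -1" "j = -1"
      using ex[OF i] ex[OF j] by blast
    then show ?thesis
    proof cases
      case (1 m n) then show ?thesis using main[of m n f x] by simp
    next
      case (2 n)
      have "-1 + int n = int n - 1" by simp
      then show ?thesis unfolding 2 using low[of n f x] by (simp del: of_nat_Suc)
    next
      case (3 m)
      have "int m + -1 = int m - 1" by simp
      then show ?thesis unfolding 3 using low[of m f x]
        by (simp only: poly_diff poly_smult) (simp add: algebra_simps)
    next
      case 4 then show ?thesis by simp
    qed
  qed
  then show "?B i (?B j f) - ?B j (?B i f) = smult (of_int (j - i)) (?B (i + j) f)"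
    using poly_eq_poly_eq_iff by blast
qed

end

theory Submission
  imports Defs
begin

text \<open>
  Write \<open>x\<close> for \<open>d_0\<close>.  The relation \<open>[d_0, d_i] = i d_i\<close> forces \<open>d_i\<close> to act by
  \<open>f(x) \<mapsto> g_i(x) f(x - i)\<close> with a fixed polynomial \<open>g_i\<close>, the symbol of \<open>d_i\<close>
  (lemma \<open>act_W1p_d\<close>), so a module structure is a family of symbols satisfying
  \<open>g_i(x) g_j(x - i) - g_j(x) g_i(x - j) = (j - i) g_(i+j)(x)\<close>.  Since \<open>d_(-1)\<close> and \<open>d_2\<close>
  generate the Lie algebra, only \<open>g_(-1)\<close> and \<open>g_2\<close> have to be identified
  (lemma \<open>W1p_isomorphic_if_agree_on_generators\<close>); the isomorphism is then the identity map.

  The relation \<open>[d_(-1), d_1] = 2 d_0\<close> says that \<open>h(x) = g_1(x) g_(-1)(x - 1)\<close> satisfies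
  \<open>h(x + 1) - h(x) = 2x\<close>, so \<open>h = x^2 - x + k\<close> and \<open>g_(-1)\<close> has degree at most 2.  Next comes
  \<open>[d_(-1), d_2] = 3 d_1\<close>, an equation \<open>g_(-1)(x) g_2(x + 1) - g_2(x) g_(-1)(x - 2) = 3 g_1(x)\<close>
  for \<open>g_2\<close>.  Its left-hand side has degree \<open>deg g_(-1) + deg g_2 - 1\<close> whenever this is not
  negative, because the leading terms combine with the nonzero factor
  \<open>deg g_2 + 2 deg g_(-1)\<close> (lemma \<open>coeff_twisted_difference\<close>).

  Hence degree 2 is impossible, as \<open>g_1\<close> would then be constant.  In degree 1 the equation
  has at most one solution \<open>g_2\<close>, and the module is some \<open>\<Omega>(\<lambda>, a)\<close>.  In degree 0 it
  determines \<open>g_2\<close> up to a constant.  Here \<open>d_3\<close> and \<open>d_4\<close> are brackets formed from \<open>d_1\<close> and \<open>d_2\<close>,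
  and the relation \<open>3 [d_2, d_3] = [d_1, d_4]\<close>, both sides being \<open>3 d_5\<close>, becomes a quadratic
  equation for the constant (lemma \<open>gamma_constant\<close>).  Its two roots give \<open>\<Gamma>(\<lambda>, a)\<close> and
  \<open>\<Gamma>(\<lambda>, - 1 - a)\<close>: the symbol \<open>g_1 = \<lambda> (x - (a + 1)) (x + a)\<close> is invariant under
  \<open>a \<mapsto> - 1 - a\<close> and so cannot tell these two modules apart.
\<close>

section \<open>Generation by two elements\<close>

lemma W1p_bracket_d_fun:
  assumes "i \<ge> -1" "j \<ge> -1"
  shows "W1p_bracket (W1p_d i) (W1p_d j) = (\<lambda>f. smult (of_int (j - i)) (W1p_d (i + j) f))"
  using W1p_bracket_d[OF assms] by (rule ext)

text \<open>
  Agreement passes to brackets, and \<open>[d_(-1), d_2] = 3 d_1\<close>, \<open>[d_(-1), d_1] = 2 d_0\<close> and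
  \<open>[d_1, d_n] = (n - 1) d_(n+1)\<close> for \<open>n \<ge> 2\<close> reach the whole basis.
\<close>
lemma W1p_modules_eq_if_agree_on_generators:
  fixes scale :: "complex \<Rightarrow> 'v::ab_group_add \<Rightarrow> 'v"
  assumes "W1p_module scale act" "W1p_module scale act'"
    and neg: "\<And>v. act (W1p_d (-1)) v = act' (W1p_d (-1)) v"
    and two: "\<And>v. act (W1p_d 2) v = act' (W1p_d 2) v"
    and D: "D \<in> W1p"
  shows "act D v = act' D v"
proof -
  interpret M: W1p_module scale act by fact
  interpret N: W1p_module scale act' by fact
  have smult_agree: "act (\<lambda>f. smult c (E f)) v = act' (\<lambda>f. smult c (E f)) v"
    if "E \<in> W1p" "act E v = act' E v" for c E v
    using that by (simp add: M.act_smult N.act_smult)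
  have bracket_agree: "act (W1p_d k) v = act' (W1p_d k) v"
    if "i \<ge> -1" "j \<ge> -1" "j \<noteq> i" "k = i + j"
      and i: "\<And>v. act (W1p_d i) v = act' (W1p_d i) v"
      and j: "\<And>v. act (W1p_d j) v = act' (W1p_d j) v" for i j k v
  proof -
    have "W1p_d k = (\<lambda>f. smult (inverse (of_int (j - i))) (W1p_bracket (W1p_d i) (W1p_d j) f))"
      using that(1-4) by (simp add: W1p_bracket_d)
    moreover have "act (W1p_bracket (W1p_d i) (W1p_d j)) v = act' (W1p_bracket (W1p_d i) (W1p_d j)) v"
      by (simp add: M.act_bracket N.act_bracket W1p_d_in i j)
    ultimately show ?thesis
      using smult_agree[OF W1p_bracket_in[OF W1p_d_in W1p_d_in]] by metis
  qed
  have one: "act (W1p_d 1) v = act' (W1p_d 1) v" for v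
    by (rule bracket_agree[of "-1" 2]) (simp_all add: neg two)
  have zero: "act (W1p_d 0) v = act' (W1p_d 0) v" for v
    by (rule bracket_agree[of "-1" 1]) (simp_all add: neg one)
  have high: "act (W1p_d (int n + 2)) v = act' (W1p_d (int n + 2)) v" for n v
  proof (induction n arbitrary: v)
    case 0
    show ?case using two by simp
  next
    case (Suc n)
    show ?case by (rule bracket_agree[of 1 "int n + 2"]) (simp_all add: one Suc.IH)
  qed
  have basis: "act (W1p_d (int n - 1)) v = act' (W1p_d (int n - 1)) v" for n v
  proof -
    have "n = 0 \<or> n = 1 \<or> n = 2 \<or> (\<exists>k. n = k + 3)" by presburger
    then consider "n = 0" | "n = 1" | "n = 2" | k where "n = k + 3" by blast
    then show ?thesis
    proof cases
      case (4 k)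
      then have "int n - 1 = int k + 2" by simp
      then show ?thesis by (simp only: high)
    qed (simp_all add: neg zero one)
  qed
  have "act (\<lambda>f. p * pderiv f) v = act' (\<lambda>f. p * pderiv f) v" for p v
  proof (induction p rule: poly_monom_induct)
    case 1
    show ?case using M.act_smult[OF W1p_d_in, of 0] N.act_smult[OF W1p_d_in, of 0] by simp
  next
    case (2 p q)
    then show ?case
      by (simp add: distrib_right M.act_add N.act_add W1p_mult_pderiv)
  next
    case (3 c n)
    have "monom c n * pderiv f = smult c (W1p_d (int n - 1) f)" for f
      by (simp add: W1p_d_def smult_monom flip: mult_smult_left)
    then show ?case using smult_agree[OF W1p_d_in basis] by simp
  qed
  moreover have "D = (\<lambda>f. D [:0, 1:] * pderiv f)"
    using W1p_eq[OF D] by blast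
  ultimately show ?thesis by metis
qed

lemma W1p_isomorphic_if_agree_on_generators:
  assumes "W1p_module scale act" "W1p_module scale act'"
    and "\<And>v. act (W1p_d (-1)) v = act' (W1p_d (-1)) v"
    and "\<And>v. act (W1p_d 2) v = act' (W1p_d 2) v"
  shows "W1p_isomorphic scale act scale act'"
proof -
  interpret M: W1p_module scale act by fact
  have "Vector_Spaces.linear scale scale (\<lambda>v. v)"
    by (rule M.linear_ident)
  moreover have "bij (\<lambda>v. v)" by (rule bij_id[unfolded id_def])
  ultimately show ?thesis
    unfolding W1p_isomorphic_def
    using assms(1,2) W1p_modules_eq_if_agree_on_generators[OF assms] by blast
qed

section \<open>Leading terms of twisted differences\<close>

lemma shift_mult: "shift i (f * g) = shift i f * shift i g"
  by (simp add: shift_def pcompose_mult)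

lemma shift_diff: "shift i (f - g) = shift i f - shift i g"
  by (simp add: shift_def pcompose_diff)

lemma shift_shift: "shift i (shift j f) = shift (i + j) f"
proof (rule poly_ext)
  fix x :: complex
  have "x - of_int i - of_int j = x - of_int (i + j)" by simp
  then show "poly (shift i (shift j f)) x = poly (shift (i + j) f) x"
    by (simp only: poly_shift)
qed

lemma shift_const: "shift i [:c:] = [:c:]"
  by (simp add: shift_def)

lemma degree_shift: "degree (shift i f) = degree f"
  by (simp add: shift_def degree_pcompose)

lemma coeff_mult_at_degree_bounds:
  fixes p q :: "'a::comm_semiring_0 poly"
  assumes "degree p \<le> m" "degree q \<le> n"
  shows "coeff (p * q) (m + n) = coeff p m * coeff q n"
proof (cases "degree p = m \<and> degree q = n")
  case True
  then show ?thesis using coeff_mult_degree_sum[of p q] by simp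
next
  case False
  then have "degree (p * q) < m + n" and "coeff p m * coeff q n = 0"
    using degree_mult_le[of p q] assms by (auto simp: coeff_eq_0 order_le_less)
  then show ?thesis by (simp add: coeff_eq_0)
qed

text \<open>
  To leading order \<open>f(x) - f(x - i)\<close> is \<open>i f'(x)\<close>.  The bound is stated for \<open>degree f \<le> Suc n\<close>
  instead of equality to make the induction on the coefficients go through.
\<close>
lemma shift_difference_leading:
  assumes "degree f \<le> Suc n"
  shows "degree (f - shift i f) \<le> n \<and> coeff (f - shift i f) n = of_int i * of_nat (Suc n) * coeff f (Suc n)"
  using assms
proof (induction f arbitrary: n)
  case 0
  show ?case by (simp add: shift_def)
next
  case (pCons a f)
  have split: "pCons a f - shift i (pCons a f) = pCons 0 (f - shift i f) + smult (of_int i) (shift i f)"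
    by (simp add: shift_def pcompose_pCons algebra_simps)
  show ?case
  proof (cases n)
    case 0
    then have "degree f = 0" using pCons.prems by (auto split: if_splits)
    then obtain b where "f = [:b:]" using degree_eq_zeroE by blast
    then show ?thesis unfolding split by (simp add: shift_const 0)
  next
    case (Suc m)
    then have d: "degree f \<le> Suc m" using pCons.prems by (auto split: if_splits)
    have "coeff (shift i f) (Suc m) = coeff f (Suc m)"
    proof -
      have "coeff (f - shift i f) (Suc m) = 0"
        using pCons.IH[OF d] by (simp only: coeff_eq_0 le_imp_less_Suc)
      then show ?thesis by simp
    qed
    moreover have "degree (pCons 0 (f - shift i f) + smult (of_int i) (shift i f)) \<le> Suc m"
    proof (rule degree_add_le)
      show "degree (pCons 0 (f - shift i f)) \<le> Suc m"
        using pCons.IH[OF d] by simp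
      show "degree (smult (of_int i) (shift i f)) \<le> Suc m"
        using d by (simp add: degree_shift)
    qed
    ultimately show ?thesis
      unfolding split Suc using pCons.IH[OF d] by (simp add: algebra_simps)
  qed
qed

lemma coeff_mult_shift_difference:
  assumes "degree u + degree f = Suc n"
  shows "coeff (u * (f - shift i f)) n = of_int i * of_nat (degree f) * (lead_coeff u * lead_coeff f)"
proof (cases "degree f")
  case 0
  then show ?thesis by (metis cancel_comm_monoid_add_class.diff_cancel coeff_0 degree_eq_zeroE
      mult_zero_left mult_zero_right of_nat_0 shift_const)
next
  case (Suc m)
  then have "n = degree u + m" using assms by simp
  then show ?thesis
    using coeff_mult_at_degree_bounds[of u "degree u" "f - shift i f" m]
      shift_difference_leading[of f m i] Suc by (simp add: mult_ac)
qed

text \<open>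
  The top terms of the two products cancel, and the next ones are the leading terms of
  \<open>u f' + i u' f\<close>.  This expression is the left-hand side of the relation for
  \<open>[d_(-1), d_i]\<close>, with \<open>u\<close> and \<open>f\<close> the symbols of \<open>d_(-1)\<close> and \<open>d_i\<close>.
\<close>
lemma coeff_twisted_difference:
  assumes "degree u + degree f = Suc n"
  shows "coeff (u * shift (-1) f - f * shift i u) n =
    (of_nat (degree f) + of_int i * of_nat (degree u)) * (lead_coeff u * lead_coeff f)"
proof -
  have "u * shift (-1) f - f * shift i u = f * (u - shift i u) - u * (f - shift (-1) f)"
    by (simp add: algebra_simps)
  moreover have "degree f + degree u = Suc n" using assms by simp
  ultimately show ?thesis
    using coeff_mult_shift_difference[OF assms, of "-1"]
      coeff_mult_shift_difference[of f u n i]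
    by (simp add: algebra_simps)
qed

lemma coeff_twisted_difference_nonzero:
  assumes "degree u + degree f = Suc n" "u \<noteq> 0" "f \<noteq> 0" "i > 0"
  shows "coeff (u * shift (-1) f - f * shift i u) n \<noteq> 0"
proof -
  have "int (degree f) + i * int (degree u) > 0"
  proof (cases "degree f")
    case 0
    then show ?thesis using assms(1,4) by simp
  next
    case (Suc m)
    moreover have "i * int (degree u) \<ge> 0" using assms(4) by simp
    ultimately show ?thesis by linarith
  qed
  then have "of_int (int (degree f) + i * int (degree u)) \<noteq> (0 :: complex)"
    by (metis less_irrefl of_int_0_eq_iff)
  then show ?thesis
    using coeff_twisted_difference[OF assms(1), of i] assms(2,3) by simp
qed

lemma shift_invariant_imp_constant:
  assumes "shift (-1) f = f"
  obtains c where "f = [:c:]"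
proof (cases "degree f")
  case 0
  then show ?thesis using that degree_eq_zeroE by blast
next
  case (Suc n)
  then have "coeff (1 * shift (-1) f - f * shift 1 1) n \<noteq> 0"
    by (intro coeff_twisted_difference_nonzero) auto
  then show ?thesis using assms by (simp add: shift_const one_pCons)
qed

section \<open>Symbols of the basis elements\<close>

locale d0_free_module = W1p_module smult act
  for act :: "(complex poly \<Rightarrow> complex poly) \<Rightarrow> complex poly \<Rightarrow> complex poly" +
  assumes act_d0: "act (W1p_d 0) f = [:0, 1:] * f"
begin

definition symbol :: "int \<Rightarrow> complex poly" where
  "symbol i = act (W1p_d i) 1"

text \<open>
  The relation \<open>[d_0, d_i] = i d_i\<close> reads \<open>d_i (x f) = (x - i) d_i f\<close>: moving \<open>d_i\<close> past
  the variable shifts it, so the value at 1 determines everything.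
\<close>
lemma act_W1p_d:
  assumes "i \<ge> -1"
  shows "act (W1p_d i) f = symbol i * shift i f"
proof (induction f)
  note lin = linear_smultD[OF act_linear[OF W1p_d_in]]
  case 0
  show ?case using lin(2)[of i 0 0] by (simp add: shift_def)
next
  note lin = linear_smultD[OF act_linear[OF W1p_d_in]]
  case (pCons c f)
  have "act (W1p_bracket (W1p_d 0) (W1p_d i)) f = smult (of_int i) (act (W1p_d i) f)"
    using act_smult[OF W1p_d_in, of "of_int i" i f] assms
      by (simp add: W1p_bracket_d_fun)
  then have X: "act (W1p_d i) ([:0, 1:] * f) = [:- of_int i, 1:] * act (W1p_d i) f"
    by (simp only: act_bracket[OF W1p_d_in W1p_d_in] act_d0) (simp add: algebra_simps)
  have "pCons c f = smult c 1 + [:0, 1:] * f" by (simp add: one_pCons)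
  then have "act (W1p_d i) (pCons c f) = smult c (symbol i) + [:- of_int i, 1:] * (symbol i * shift i f)"
    by (simp only: lin X pCons.IH symbol_def)
  also have "\<dots> = symbol i * shift i (pCons c f)"
    by (simp add: shift_def pcompose_pCons algebra_simps)
  finally show ?case .
qed

lemma symbol_bracket:
  assumes "i \<ge> -1" "j \<ge> -1" "i + j \<ge> -1"
  shows "symbol i * shift i (symbol j) - symbol j * shift j (symbol i) = smult (of_int (j - i)) (symbol (i + j))"
proof -
  have "act (W1p_bracket (W1p_d i) (W1p_d j)) 1 = smult (of_int (j - i)) (symbol (i + j))"
    using act_smult[OF W1p_d_in, of "of_int (j - i)" "i + j" 1] assms
      by (simp add: W1p_bracket_d_fun symbol_def)
  then show ?thesis
    using assms by (simp add: act_bracket W1p_d_in act_W1p_d flip: symbol_def)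
qed

lemma symbol_0: "symbol 0 = [:0, 1:]"
  by (simp add: symbol_def act_d0)

lemma poly_symbol_bracket:
  assumes "i \<ge> -1" "j \<ge> -1" "i + j \<ge> -1"
  shows "poly (symbol i) x * poly (symbol j) (x - of_int i) - poly (symbol j) x * poly (symbol i) (x - of_int j)
    = of_int (j - i) * poly (symbol (i + j)) x"
  using arg_cong[OF symbol_bracket[OF assms], of "\<lambda>p. poly p x"] by (simp add: poly_shift)

text \<open>
  The relation \<open>[d_(-1), d_1] = 2 d_0\<close> makes the forward difference of this product equal to
  \<open>2x\<close>, and a difference equation determines a polynomial up to a constant.
\<close>
lemma symbol_1_times_shifted_symbol_neg:
  obtains c where "symbol 1 * shift 1 (symbol (-1)) = [:c, -1, 1:]"
proof -
  let ?h = "symbol 1 * shift 1 (symbol (-1))"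
  have "shift (-1) ?h = symbol (-1) * shift (-1) (symbol 1)"
    by (simp add: shift_mult shift_shift) (simp add: shift_def)
  moreover have "symbol (-1) * shift (-1) (symbol 1) - ?h = [:0, 2:]"
    using symbol_bracket[of "-1" 1] by (simp add: symbol_0)
  moreover have "shift (-1) [:0, -1, 1:] = [:0, -1, 1:] + [:0, 2:]"
    by (simp add: shift_def pcompose_pCons)
  ultimately have "shift (-1) (?h - [:0, -1, 1:]) = ?h - [:0, -1, 1:]"
    by (simp add: shift_diff algebra_simps)
  then obtain c where "?h - [:0, -1, 1:] = [:c:]"
    using shift_invariant_imp_constant by blast
  then have "?h = [:c, -1, 1:]" by (simp add: algebra_simps)
  then show ?thesis by (rule that)
qed

lemma symbol_bracket_neg_2:
  "symbol (-1) * shift (-1) (symbol 2) - symbol 2 * shift 2 (symbol (-1)) = smult 3 (symbol 1)"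
  using symbol_bracket[of "-1" 2] by simp

lemma degree_symbol_neg: "degree (symbol 1) + degree (symbol (-1)) = 2" "symbol 1 \<noteq> 0" "symbol (-1) \<noteq> 0"
proof -
  obtain c where h: "symbol 1 * shift 1 (symbol (-1)) = [:c, -1, 1:]"
    by (rule symbol_1_times_shifted_symbol_neg)
  then show "symbol 1 \<noteq> 0" "symbol (-1) \<noteq> 0" by (auto simp: shift_def)
  then have "shift 1 (symbol (-1)) \<noteq> 0" using h by auto
  then show "degree (symbol 1) + degree (symbol (-1)) = 2"
    using degree_mult_eq[OF \<open>symbol 1 \<noteq> 0\<close>, of "shift 1 (symbol (-1))"] h
    by (simp add: degree_shift)
qed

text \<open>
  Otherwise \<open>symbol 1\<close> is a nonzero constant, whereas \<open>[d_(-1), d_2] = 3 d_1\<close> equates its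
  triple with a polynomial of positive degree.
\<close>
lemma degree_symbol_neg_le_1: "degree (symbol (-1)) \<le> 1"
proof (rule ccontr)
  assume "\<not> ?thesis"
  then have d: "degree (symbol (-1)) = 2" "degree (symbol 1) = 0" using degree_symbol_neg(1) by auto
  have "symbol 2 \<noteq> 0" using symbol_bracket_neg_2 degree_symbol_neg(2) by (auto simp: shift_def)
  define n where "n = Suc (degree (symbol 2))"
  have "coeff (smult 3 (symbol 1)) n = 0" using d(2) by (simp add: n_def coeff_eq_0)
  moreover have "coeff (symbol (-1) * shift (-1) (symbol 2) - symbol 2 * shift 2 (symbol (-1))) n \<noteq> 0"
    using d(1) \<open>symbol 2 \<noteq> 0\<close> degree_symbol_neg(3)
    by (intro coeff_twisted_difference_nonzero) (simp_all add: n_def)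
  ultimately show False by (simp add: symbol_bracket_neg_2)
qed

section \<open>The modules with linear symbol of the lowest basis element\<close>

text \<open>
  Comparing coefficients in \<open>symbol 1 * shift 1 (symbol (-1))\<close> fixes both factors in terms of
  \<open>\<lambda>\<close> and \<open>a\<close>.  The symbol of \<open>d_2\<close> in \<open>\<Omega>(\<lambda>, a)\<close> solves the relation
  \<open>[d_(-1), d_2] = 3 d_1\<close>, and the difference of two solutions is killed by the twisted difference,
  which is injective since \<open>symbol (-1)\<close> has positive degree.
\<close>
lemma isomorphic_Omega:
  assumes "degree (symbol (-1)) = 1"
  obtains lam a where "lam \<noteq> 0" "W1p_isomorphic smult act smult (Omega lam a)"
proof -
  have d1: "degree (symbol 1) = 1" using assms degree_symbol_neg(1) by simp
  obtain q r where neg: "symbol (-1) = [:r, q:]" and q: "q \<noteq> 0"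
    using assms degree_symbol_neg(3) by (cases "symbol (-1)" rule: pCons_cases)
      (metis One_nat_def degree_eq_zeroE degree_pCons_eq degree_pCons_0 nat.inject pCons_eq_0_iff
        pCons_cases zero_neq_one)
  obtain p s where one: "symbol 1 = [:s, p:]"
    using d1 degree_symbol_neg(2) by (cases "symbol 1" rule: pCons_cases)
      (metis One_nat_def degree_eq_zeroE degree_pCons_eq degree_pCons_0 nat.inject
        pCons_cases zero_neq_one)
  define lam where "lam = inverse q"
  define a where "a = r * lam - 1"
  have lam: "lam \<noteq> 0" using q by (simp add: lam_def)
  obtain c where "symbol 1 * shift 1 (symbol (-1)) = [:c, -1, 1:]"
    by (rule symbol_1_times_shifted_symbol_neg)
  then have "p * q = 1" "s * q + p * (r - q) = -1"
    by (auto simp: one neg shift_def pcompose_pCons mult.commute add.commute)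
  moreover from this have "s * q = - (p * r)"
    by (simp add: right_diff_distrib eq_neg_iff_add_eq_0)
  ultimately have p: "p = lam" and s: "s = - lam * (a + 1)"
    using q by (simp_all add: lam_def a_def field_simps)
  have neg': "symbol (-1) = smult (lam powi (-1)) [:a + 1, 1:]"
    using q by (simp add: neg lam_def a_def)
  let ?w = "smult (lam\<^sup>2) [:- 2 * (a + 1), 1:]"
  let ?D = "symbol 2 - ?w"
  have w: "symbol (-1) * shift (-1) ?w - ?w * shift 2 (symbol (-1)) = smult 3 (symbol 1)"
    using lam
    by (intro poly_ext)
      (simp add: poly_shift neg' one p s power2_eq_square field_simps)
  have D: "symbol (-1) * shift (-1) ?D - ?D * shift 2 (symbol (-1)) = 0"
    using symbol_bracket_neg_2 w by (simp only: shift_diff) (simp add: algebra_simps)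
  have "?D = 0"
  proof (rule ccontr)
    assume "?D \<noteq> 0"
    then have "coeff (symbol (-1) * shift (-1) ?D - ?D * shift 2 (symbol (-1))) (degree ?D) \<noteq> 0"
      using assms degree_symbol_neg(3) by (intro coeff_twisted_difference_nonzero) simp_all
    then show False unfolding D by simp
  qed
  then have two: "symbol 2 = ?w" by simp
  have "W1p_isomorphic smult act smult (Omega lam a)"
    using W1p_module_axioms Omega_module[OF lam]
    by (rule W1p_isomorphic_if_agree_on_generators)
      (simp_all add: act_W1p_d Omega_d neg' two smult_add_right algebra_simps)
  then show thesis using lam that by blast
qed

section \<open>The modules with constant symbol of the lowest basis element\<close>

text \<open>
  Here \<open>c\<close> measures how far \<open>symbol 2\<close> is from the symbol of \<open>d_2\<close> in \<open>\<Gamma>(\<lambda>, a)\<close>.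
  The relation \<open>3 [d_2, d_3] = [d_1, d_4]\<close> is polynomial in \<open>c\<close> with the quadratic term coming
  from its left-hand side only.  One root is \<open>c = 0\<close>; the other is the difference between the symbols
  of \<open>d_2\<close> in \<open>\<Gamma>(\<lambda>, - 1 - a)\<close> and in \<open>\<Gamma>(\<lambda>, a)\<close>.
\<close>
lemma gamma_constant:
  fixes lam a c :: complex
  assumes lam: "lam \<noteq> 0"
    and one: "\<And>x. poly (symbol 1) x = lam * (x - (a + 1)) * (x + a)"
    and two: "\<And>x. poly (symbol 2) x = lam\<^sup>2 * ((x - 2 * (a + 1)) * (x + a) * (x + a - 1) + c)"
  shows "c = 0 \<or> c = 2 * a * (a + 1) * (2 * a + 1)"
proof -
  \<comment> \<open>At \<open>c = 0\<close> these are the symbols of \<open>d_3\<close> and \<open>d_4\<close> in \<open>\<Gamma>(\<lambda>, a)\<close>;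
    the multiples of \<open>c\<close> are the first and half the second iterated bracket of \<open>d_1\<close> with the
    shift by 2.\<close>
  have three: "poly (symbol 3) x = lam ^ 3 *
      ((x - 3 * (a + 1)) * (x + a) * (x + a - 1) * (x + a - 2) + c * (4 * x - 6))" for x
  proof -
    have "poly (symbol 3) x = poly (symbol 1) x * poly (symbol 2) (x - 1) - poly (symbol 2) x * poly (symbol 1) (x - 2)"
      using poly_symbol_bracket[of 1 2 x] by simp
    then show ?thesis unfolding one two by algebra
  qed
  have four: "poly (symbol 4) x = lam ^ 4 *
      ((x - 4 * (a + 1)) * (x + a) * (x + a - 1) * (x + a - 2) * (x + a - 3)
        + c * (10 * x\<^sup>2 - 40 * x + 36 + 2 * a * (a + 1)))" for x
  proof -
    have "2 * poly (symbol 4) x = poly (symbol 1) x * poly (symbol 3) (x - 1) - poly (symbol 3) x * poly (symbol 1) (x - 3)"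
      using poly_symbol_bracket[of 1 3 x] by simp
    also have "\<dots> = 2 * (lam ^ 4 *
      ((x - 4 * (a + 1)) * (x + a) * (x + a - 1) * (x + a - 2) * (x + a - 3)
        + c * (10 * x\<^sup>2 - 40 * x + 36 + 2 * a * (a + 1))))"
      unfolding one three by algebra
    finally show ?thesis by simp
  qed
  \<comment> \<open>The coefficient of \<open>c\<^sup>2\<close> is \<open>-3\<close> times the difference \<open>(4 (x - 2) - 6) - (4 x - 6) = -8\<close>;
    the point 0 serves as well as any other.\<close>
  have "24 * lam ^ 5 * (c * (c - 2 * a * (a + 1) * (2 * a + 1))) =
      poly (symbol 1) 0 * poly (symbol 4) (0 - 1) - poly (symbol 4) 0 * poly (symbol 1) (0 - 4) -
      3 * (poly (symbol 2) 0 * poly (symbol 3) (0 - 2) - poly (symbol 3) 0 * poly (symbol 2) (0 - 3))"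
    unfolding one two three four by (simp add: algebra_simps eval_nat_numeral)
  also have "\<dots> = 0"
    using poly_symbol_bracket[of 1 4 0] poly_symbol_bracket[of 2 3 0] by simp
  finally have "24 * lam ^ 5 * (c * (c - 2 * a * (a + 1) * (2 * a + 1))) = 0" .
  then show ?thesis using lam by simp
qed

text \<open>
  With \<open>symbol (-1)\<close> constant, the relation \<open>[d_(-1), d_2] = 3 d_1\<close> prescribes the forward
  difference of \<open>symbol 2\<close>, which leaves one free constant for the preceding lemma to settle.
\<close>
lemma isomorphic_Gamma:
  assumes "degree (symbol (-1)) = 0"
  obtains lam a where "lam \<noteq> 0" "W1p_isomorphic smult act smult (Gamma lam a)"
proof -
  obtain q where neg: "symbol (-1) = [:q:]" using assms degree_eq_zeroE by blast
  then have q: "q \<noteq> 0" using degree_symbol_neg(3) by auto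
  define lam where "lam = inverse q"
  have lam: "lam \<noteq> 0" and neg': "symbol (-1) = [:inverse lam:]" using q neg by (simp_all add: lam_def)
  obtain k where k: "symbol 1 * shift 1 (symbol (-1)) = [:k, -1, 1:]"
    by (rule symbol_1_times_shifted_symbol_neg)
  \<comment> \<open>A root of \<open>a\<^sup>2 + a + k = 0\<close>, so that \<open>x\<^sup>2 - x + k\<close> factors as \<open>(x - (a + 1)) (x + a)\<close>.\<close>
  define a where "a = (csqrt (1 - 4 * k) - 1) / 2"
  have "(2 * a + 1)\<^sup>2 = 1 - 4 * k" by (simp add: a_def diff_divide_distrib)
  then have a: "k = - (a * (a + 1))" by algebra
  have one: "poly (symbol 1) x = lam * (x - (a + 1)) * (x + a)" for x
  proof -
    have "symbol 1 = smult lam [:k, -1, 1:]"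
      using lam by (simp flip: k add: neg' shift_const)
    then show ?thesis by (simp add: a algebra_simps)
  qed
  let ?w = "\<lambda>a. smult (lam\<^sup>2) ([:- 2 * (a + 1), 1:] * [:a, 1:] * [:a - 1, 1:])"
  have w: "shift (-1) (?w a) - ?w a = smult (3 * lam) (symbol 1)"
    by (rule poly_ext) (simp add: poly_shift one, algebra)
  have "smult (inverse lam) (shift (-1) (symbol 2) - symbol 2) = smult 3 (symbol 1)"
    using symbol_bracket_neg_2 by (simp add: neg' shift_const smult_diff_right)
  then have "shift (-1) (symbol 2) - symbol 2 = smult (3 * lam) (symbol 1)"
    using lam by (metis left_inverse mult.commute smult_1_left smult_smult)
  then have "shift (-1) (symbol 2 - ?w a) = symbol 2 - ?w a"
    using w by (simp only: shift_diff) (simp add: algebra_simps)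
  then obtain e where "symbol 2 - ?w a = [:e:]" using shift_invariant_imp_constant by blast
  then have e: "symbol 2 = ?w a + [:e:]" by (simp only: diff_eq_eq add.commute)
  define c where "c = e / lam\<^sup>2"
  have two: "poly (symbol 2) x = lam\<^sup>2 * ((x - 2 * (a + 1)) * (x + a) * (x + a - 1) + c)" for x
    using lam by (simp add: e c_def field_simps)
  have Gamma: "W1p_isomorphic smult act smult (Gamma lam b)" if "symbol 2 = ?w b" for b
    using W1p_module_axioms Gamma_module[OF lam]
  proof (rule W1p_isomorphic_if_agree_on_generators)
    show "act (W1p_d (-1)) v = Gamma lam b (W1p_d (-1)) v" for v
      by (simp add: act_W1p_d Gamma_d Gamma_basis_def neg')
    have "(\<Prod>i<2. [:b - of_nat i, 1:]) = [:b, 1:] * [:b - 1, 1:]"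
      by (simp add: numeral_2_eq_2)
    then show "act (W1p_d 2) v = Gamma lam b (W1p_d 2) v" for v
      by (intro poly_ext)
        (simp add: act_W1p_d Gamma_d Gamma_basis_def that poly_shift algebra_simps)
  qed
  have "symbol 2 = ?w a \<or> symbol 2 = ?w (- 1 - a)"
    using gamma_constant[OF lam one two]
  proof
    assume "c = 0"
    then have "symbol 2 = ?w a" using e by (simp add: c_def lam)
    then show ?thesis ..
  next
    \<comment> \<open>The identity is \<open>(x - 2 (a + 1)) (x + a) (x + a - 1) + c = (x + 2 a) (x - 1 - a) (x - 2 - a)\<close>.\<close>
    assume "c = 2 * a * (a + 1) * (2 * a + 1)"
    then have "symbol 2 = ?w (- 1 - a)"
      by (intro poly_ext) (simp add: two algebra_simps)
    then show ?thesis ..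
  qed
  then show thesis using Gamma lam that by blast
qed

end

theorem theorem2:
  fixes act :: "(complex poly \<Rightarrow> complex poly) \<Rightarrow> complex poly \<Rightarrow> complex poly"
  assumes "W1p_module smult act"
    and "\<And>f. act (W1p_d 0) f = [:0, 1:] * f"
  shows "(\<exists>lam a. lam \<noteq> 0 \<and> W1p_isomorphic smult act smult (Omega lam a)) \<or>
         (\<exists>lam a. lam \<noteq> 0 \<and> W1p_isomorphic smult act smult (Gamma lam a))"
proof -
  interpret M: d0_free_module act
    using assms by (intro d0_free_module.intro d0_free_module_axioms.intro)
  consider "degree (M.symbol (-1)) = 1" | "degree (M.symbol (-1)) = 0"
    using M.degree_symbol_neg_le_1 by linarith
  then show ?thesis
    by cases (metis M.isomorphic_Omega, metis M.isomorphic_Gamma)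
qed

end
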